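(* Let $m,n$ be positive integers with $m\ge 6$, $n\ge m+3$ and $2\nmid m(n-1)$. Then $$r(K_{1,m-1},T_n'')=r(K_{1,m-1},T_n''')=m+n-6.$$
   Context: All graphs are finite simple graphs. For graphs $G_1,G_2$, the Ramsey number $r(G_1,G_2)$ is the smallest positive integer $N$ such that for every graph $G$ on $N$ vertices, either $G$ contains a (not necessarily induced) subgraph isomorphic to $G_1$, or the complement $\overline{G}$ contains a subgraph isomorphic to $G_2$. $K_{1,m-1}$ is the star on $m$ vertices. For $n\ge 6$, on vertex set $\{v_0,v_1,\ldots,v_{n-1}\}$: $T_n''$ is the tree with edges $v_0v_1,\ldots,v_0v_{n-4},v_1v_{n-3},v_1v_{n-2},v_2v_{n-1}$; $T_n'''$ is the tree with edges $v_0v_1,\ldots,v_0v_{n-4},v_1v_{n-3},v_2v_{n-2},v_3v_{n-1}$. *)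

theory Defs
  imports Main
begin

record 'a sgraph =
  verts :: "'a set"
  edges :: "'a set set"

definition simple_graph :: "'a sgraph \<Rightarrow> bool" where
  "simple_graph G \<longleftrightarrow>
     finite (verts G) \<and> (\<forall>e\<in>edges G. e \<subseteq> verts G \<and> card e = 2)"

definition complement :: "'a sgraph \<Rightarrow> 'a sgraph" where
  "complement G =
     \<lparr>verts = verts G, edges = {e. e \<subseteq> verts G \<and> card e = 2} - edges G\<rparr>"

definition subgraph :: "'a sgraph \<Rightarrow> 'a sgraph \<Rightarrow> bool" where
  "subgraph H G \<longleftrightarrow>
     simple_graph H \<and> verts H \<subseteq> verts G \<and> edges H \<subseteq> edges G"

definition isomorphic :: "'a sgraph \<Rightarrow> 'b sgraph \<Rightarrow> bool" where
  "isomorphic G H \<longleftrightarrow>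
     (\<exists>f. bij_betw f (verts G) (verts H) \<and> edges H = (\<lambda>e. f ` e) ` edges G)"

definition contains_copy :: "'a sgraph \<Rightarrow> 'b sgraph \<Rightarrow> bool" where
  "contains_copy G H \<longleftrightarrow> (\<exists>H'. subgraph H' G \<and> isomorphic H H')"

(* Host graphs range over the finite simple graphs whose vertices are natural
   numbers; every finite simple graph is isomorphic to one of these. *)
definition ramsey_number :: "'a sgraph \<Rightarrow> 'b sgraph \<Rightarrow> nat" where
  "ramsey_number G1 G2 =
     (LEAST N. 0 < N \<and>
        (\<forall>G :: nat sgraph. simple_graph G \<and> card (verts G) = N \<longrightarrow>
           contains_copy G G1 \<or> contains_copy (complement G) G2))"

(* K_{1,k}: centre 0 and k leaves, hence k + 1 vertices. *)
definition star :: "nat \<Rightarrow> nat sgraph" where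
  "star k = \<lparr>verts = {0..k}, edges = {{0, i} |i. i \<in> {1..k}}\<rparr>"

(* In the two trees below, the number i stands for the vertex v_i.  The
   definitions are meant for n >= 6, where no subtraction truncates. *)
definition tree_T2 :: "nat \<Rightarrow> nat sgraph" where
  "tree_T2 n =
     \<lparr>verts = {0..<n},
      edges = {{0, i} |i. i \<in> {1..n - 4}} \<union> {{1, n - 3}, {1, n - 2}, {2, n - 1}}\<rparr>"

definition tree_T3 :: "nat \<Rightarrow> nat sgraph" where
  "tree_T3 n =
     \<lparr>verts = {0..<n},
      edges = {{0, i} |i. i \<in> {1..n - 4}} \<union> {{1, n - 3}, {2, n - 2}, {3, n - 1}}\<rparr>"

lemma simple_graph_complement: "simple_graph G \<Longrightarrow> simple_graph (complement G)"
  by (auto simp: simple_graph_def complement_def)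

lemma simple_graph_star: "simple_graph (star k)"
  by (auto simp: simple_graph_def star_def)

lemma simple_graph_tree_T2: "6 \<le> n \<Longrightarrow> simple_graph (tree_T2 n)"
  by (auto simp: simple_graph_def tree_T2_def card_insert_if)

lemma simple_graph_tree_T3: "6 \<le> n \<Longrightarrow> simple_graph (tree_T3 n)"
  by (auto simp: simple_graph_def tree_T3_def card_insert_if)

end

theory Submission
  imports Defs
begin

text \<open>Here \<open>m\<close> is odd and \<open>n\<close> is even. The lower bound comes from a circulant graph of degree
  \<open>m - 3\<close> on \<open>m + n - 7\<close> vertices: its complement has degree \<open>n - 5\<close>, one less than the centre
  of either tree needs. For the upper bound, let \<open>H\<close> be the complement of a graph on
  \<open>m + n - 6\<close> vertices without the star. Then \<open>H\<close> has minimum degree at least \<open>n - 5\<close>; as both the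
  order and \<open>n - 5\<close> are odd, some vertex \<open>v\<close> has degree at least \<open>n - 4\<close>. With \<open>v\<close> as centre it
  remains to find the three pendant edges. Every vertex outside the closed neighbourhood of \<open>v\<close>
  has several neighbours among those of \<open>v\<close>, so a greedy choice works if \<open>v\<close> has degree larger
  than \<open>n - 4\<close>. If the degree is \<open>n - 4\<close>, the edges must end outside the neighbourhood. For
  \<open>tree_T2\<close>, double counting gives a neighbour of \<open>v\<close> with two outer neighbours. For \<open>tree_T3\<close>,
  where one may assume that \<open>v\<close> has maximum degree, the absence of a matching of size 3 forces all
  outer vertices to have the same two neighbours \<open>a\<close> and \<open>b\<close> next to \<open>v\<close>; the degree bound on
  \<open>a\<close> and \<open>b\<close> then leaves some other neighbour of \<open>v\<close> with too small a degree.\<close>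

section \<open>Neighbourhoods and degree counting\<close>

definition nbhd :: "'a sgraph \<Rightarrow> 'a \<Rightarrow> 'a set" where
  "nbhd G v = {w. {v, w} \<in> edges G}"

lemma nbhd_sym: "w \<in> nbhd G v \<longleftrightarrow> v \<in> nbhd G w"
  by (simp add: nbhd_def insert_commute)

lemma nbhd_subset: "simple_graph G \<Longrightarrow> nbhd G v \<subseteq> verts G - {v}"
  by (auto simp: simple_graph_def nbhd_def)

lemma nbhd_irrefl: "simple_graph G \<Longrightarrow> v \<notin> nbhd G v"
  using nbhd_subset by fastforce

lemma finite_nbhd: "simple_graph G \<Longrightarrow> finite (nbhd G v)"
  using nbhd_subset[of G v] finite_subset by (auto simp: simple_graph_def)

text \<open>Excluded vertices are given as a list because only its length matters: the greedy
  choices below may exclude vertices without knowing whether they coincide.\<close>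

lemma ex_outside_list:
  assumes "length xs < card S"
  shows "\<exists>x\<in>S. x \<notin> set xs"
proof (rule ccontr)
  assume "\<not> ?thesis"
  then have "card S \<le> card (set xs)" by (intro card_mono) auto
  with assms card_length[of xs] show False by linarith
qed

lemma card_nbhd_complement:
  assumes "simple_graph G" "v \<in> verts G"
  shows "card (nbhd (complement G) v) + card (nbhd G v) = card (verts G) - 1"
proof -
  have "nbhd (complement G) v \<union> nbhd G v = verts G - {v}"
    using assms nbhd_subset[OF assms(1), of v] by (auto simp: nbhd_def complement_def)
  moreover have "nbhd (complement G) v \<inter> nbhd G v = {}"
    by (auto simp: nbhd_def complement_def)
  ultimately show ?thesis
    using card_Un_disjoint[OF finite_nbhd[OF simple_graph_complement[OF assms(1)]]
        finite_nbhd[OF assms(1)], of v v] assms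
    by (simp add: simple_graph_def)
qed

lemma handshake:
  assumes "simple_graph G"
  shows "(\<Sum>v\<in>verts G. card (nbhd G v)) = 2 * card (edges G)"
proof -
  have fV: "finite (verts G)" and E: "\<And>e. e \<in> edges G \<Longrightarrow> e \<subseteq> verts G \<and> card e = 2"
    using assms by (auto simp: simple_graph_def)
  have fE: "finite (edges G)"
    using finite_subset[of "edges G" "Pow (verts G)"] fV E by auto
  have "card (nbhd G v) = card {e \<in> edges G. v \<in> e}" for v
  proof -
    have "{e \<in> edges G. v \<in> e} = (\<lambda>w. {v, w}) ` nbhd G v"
    proof (intro equalityI subsetI)
      fix e assume "e \<in> {e \<in> edges G. v \<in> e}"
      then have e: "e \<in> edges G" "v \<in> e" "card e = 2" using E by auto
      then obtain w where "e = {v, w}" by (auto simp: card_2_iff)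
      with e show "e \<in> (\<lambda>w. {v, w}) ` nbhd G v" by (auto simp: nbhd_def)
    qed (auto simp: nbhd_def)
    moreover have "inj_on (\<lambda>w. {v, w}) (nbhd G v)"
      by (auto simp: inj_on_def doubleton_eq_iff)
    ultimately show ?thesis by (simp add: card_image)
  qed
  then have "(\<Sum>v\<in>verts G. card (nbhd G v)) = (\<Sum>v\<in>verts G. card {e \<in> edges G. v \<in> e})"
    by simp
  also have "\<dots> = 2 * card (edges G)"
  proof (rule sum_multicount[OF fV fE], intro ballI)
    fix e assume "e \<in> edges G"
    with E[of e] have "{v \<in> verts G. v \<in> e} = e" by auto
    with E[OF \<open>e \<in> edges G\<close>] show "card {v \<in> verts G. v \<in> e} = 2" by simp
  qed
  finally show ?thesis .
qed

section \<open>Copies of stars and trees\<close>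

lemma contains_copyI:
  assumes "simple_graph T" "simple_graph G" "inj_on f (verts T)"
    and "f ` verts T \<subseteq> verts G" "\<And>e. e \<in> edges T \<Longrightarrow> f ` e \<in> edges G"
  shows "contains_copy G T"
proof -
  let ?H = "\<lparr>verts = f ` verts T, edges = (\<lambda>e. f ` e) ` edges T\<rparr>"
  have "simple_graph ?H"
    using assms(1) card_image[OF inj_on_subset[OF assms(3)]]
    by (fastforce simp: simple_graph_def)
  then have "subgraph ?H G" using assms(4,5) by (auto simp: subgraph_def)
  moreover have "isomorphic T ?H"
    unfolding isomorphic_def using assms(3) by (intro exI[of _ f]) (auto simp: bij_betw_def)
  ultimately show ?thesis by (auto simp: contains_copy_def)
qed

text \<open>Serves to rule out copies in the lower bound: an embedding maps the neighbours of
  \<open>u\<close> injectively to neighbours of its image.\<close>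

lemma contains_copy_degree:
  assumes "simple_graph T" "simple_graph G" "contains_copy G T" "u \<in> verts T"
  shows "\<exists>v\<in>verts G. card (nbhd T u) \<le> card (nbhd G v)"
proof -
  from assms(3) obtain H where "subgraph H G" and iso: "isomorphic T H"
    by (auto simp: contains_copy_def)
  then have H: "verts H \<subseteq> verts G" "edges H \<subseteq> edges G" by (auto simp: subgraph_def)
  from iso obtain f where f: "bij_betw f (verts T) (verts H)" "edges H = (\<lambda>e. f ` e) ` edges T"
    by (auto simp: isomorphic_def)
  have "f ` nbhd T u \<subseteq> nbhd G (f u)"
  proof
    fix y assume "y \<in> f ` nbhd T u"
    then obtain w where w: "y = f w" "{u, w} \<in> edges T" by (auto simp: nbhd_def)
    then have "f ` {u, w} \<in> edges H" using f(2) by blast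
    then show "y \<in> nbhd G (f u)" using w H by (auto simp: nbhd_def)
  qed
  moreover have "inj_on f (nbhd T u)"
    using f(1) nbhd_subset[OF assms(1), of u] by (auto simp: bij_betw_def intro: inj_on_subset)
  ultimately have "card (nbhd T u) \<le> card (nbhd G (f u))"
    using card_inj_on_le finite_nbhd[OF assms(2)] by blast
  moreover have "f u \<in> verts G" using f(1) assms(4) H by (auto simp: bij_betw_def)
  ultimately show ?thesis by blast
qed

lemma contains_star:
  assumes "simple_graph G" "v \<in> verts G" "k \<le> card (nbhd G v)"
  shows "contains_copy G (star k)"
proof -
  obtain S where S: "S \<subseteq> nbhd G v" "card S = k" "finite S"
    using obtain_subset_with_card_n[OF assms(3)] finite_subset[OF _ finite_nbhd[OF assms(1)]]
    by metis
  obtain ls where ls: "set ls = S" "distinct ls" using finite_distinct_list[OF S(3)] by blast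
  then have len: "length ls = k" using S distinct_card by fastforce
  have vn: "v \<notin> S" using S nbhd_irrefl[OF assms(1)] by blast
  let ?f = "\<lambda>i. (v # ls) ! i"
  show ?thesis
  proof (rule contains_copyI[OF simple_graph_star assms(1), where f = ?f])
    show "inj_on ?f (verts (star k))"
      using ls len vn by (intro inj_on_nth) (auto simp: star_def)
    have "set (v # ls) \<subseteq> verts G"
      using ls S assms(2) nbhd_subset[OF assms(1), of v] by auto
    moreover have "?f i \<in> set (v # ls)" if "i \<in> verts (star k)" for i
      using that len by (intro nth_mem) (auto simp: star_def)
    ultimately show "?f ` verts (star k) \<subseteq> verts G" by blast
    fix e assume "e \<in> edges (star k)"
    then obtain i where i: "i \<in> {1..k}" "e = {0, i}" by (auto simp: star_def)
    have "ls ! (i - 1) \<in> set ls" by (rule nth_mem) (use i len in auto)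
    then show "?f ` e \<in> edges G" using i ls S by (auto simp: nbhd_def)
  qed
qed

text \<open>The part common to both trees: entry \<open>i\<close> of the list is the image of
  \<open>v_i\<close>, so the centre, its \<open>n - 4\<close> neighbours and the three pendant ends
  form consecutive blocks.\<close>

lemma spider_embedding:
  assumes "simple_graph G" "6 \<le> n" "v \<in> verts G"
    and ls: "set ls \<subseteq> nbhd G v" "length ls = n - 4"
    and dist: "distinct (v # ls @ [x, y, z])" and xyz: "{x, y, z} \<subseteq> verts G"
  shows "inj_on (\<lambda>i. (v # ls @ [x, y, z]) ! i) {0..<n}"
    and "(\<lambda>i. (v # ls @ [x, y, z]) ! i) ` {0..<n} \<subseteq> verts G"
    and "i \<in> {1..n - 4} \<Longrightarrow> {v, (v # ls @ [x, y, z]) ! i} \<in> edges G"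
    and "(v # ls @ [x, y, z]) ! (n - 3) = x" "(v # ls @ [x, y, z]) ! (n - 2) = y"
    and "(v # ls @ [x, y, z]) ! (n - 1) = z"
    and "0 < i \<Longrightarrow> i \<le> n - 4 \<Longrightarrow> (v # ls @ [x, y, z]) ! i = ls ! (i - 1)"
proof -
  let ?f = "\<lambda>i. (v # ls @ [x, y, z]) ! i"
  have len: "length (v # ls @ [x, y, z]) = n" using assms(2) ls(2) by simp
  show "inj_on ?f {0..<n}" using len by (intro inj_on_nth[OF dist]) (metis atLeastLessThan_iff)
  have "?f i \<in> set (v # ls @ [x, y, z])" if "i < n" for i
    by (rule nth_mem) (use that len in simp)
  moreover have "set (v # ls @ [x, y, z]) \<subseteq> verts G"
    using assms(3) ls(1) xyz nbhd_subset[OF assms(1), of v] by auto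
  ultimately show "?f ` {0..<n} \<subseteq> verts G"
    by (intro image_subsetI) (metis atLeastLessThan_iff subsetD)
  show nth: "?f i = ls ! (i - 1)" if "0 < i" "i \<le> n - 4" for i
    using that ls(2) by (cases i) (simp_all add: nth_append)
  show "{v, ?f i} \<in> edges G" if "i \<in> {1..n - 4}"
  proof -
    have "ls ! (i - 1) \<in> nbhd G v" using that ls by (intro subsetD[OF ls(1)] nth_mem) auto
    with nth[of i] that show ?thesis by (simp add: nbhd_def)
  qed
  have *: "n - 3 = Suc (length ls)" "n - 2 = Suc (length ls + 1)" "n - 1 = Suc (length ls + 2)"
    using ls(2) assms(2) by auto
  show "?f (n - 3) = x" "?f (n - 2) = y" "?f (n - 1) = z"
    unfolding * nth_Cons_Suc nth_append_length_plus by (simp_all add: nth_append)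
qed

text \<open>The prescribed elements come first, so that the neighbours of the centre carrying
  pendant edges get the indices 1, 2 and, for \<open>tree_T3\<close>, 3.\<close>

lemma leaf_list:
  assumes "finite S" "set as \<subseteq> S" "distinct as" "length as \<le> k" "k \<le> card S"
  obtains bs where "distinct (as @ bs)" "set (as @ bs) \<subseteq> S" "length (as @ bs) = k"
proof -
  have "k - length as \<le> card (S - set as)"
    using assms by (simp add: card_Diff_subset distinct_card)
  then obtain B where B: "B \<subseteq> S - set as" "card B = k - length as" "finite B"
    using obtain_subset_with_card_n assms(1) by (metis finite_Diff finite_subset)
  obtain bs where "set bs = B" "distinct bs" using finite_distinct_list[OF B(3)] by blast
  then show thesis using B assms distinct_card[of bs] by (intro that[of bs]) auto
qed

text \<open>The ends \<open>x\<close>, \<open>y\<close>, \<open>z\<close> may themselves be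
  neighbours of \<open>v\<close>; the last hypothesis says that enough other neighbours remain,
  \<open>a\<close> and \<open>b\<close> among them.\<close>

lemma contains_T2:
  assumes "simple_graph G" "6 \<le> n" "v \<in> verts G"
    and "a \<in> nbhd G v" "b \<in> nbhd G v" "a \<noteq> b"
    and "x \<in> nbhd G a" "y \<in> nbhd G a" "z \<in> nbhd G b"
    and "distinct [x, y, z]" "{x, y, z} \<inter> {v, a, b} = {}"
    and "n - 4 \<le> card (nbhd G v - {x, y, z})"
  shows "contains_copy G (tree_T2 n)"
proof -
  let ?S = "nbhd G v - {x, y, z}"
  obtain bs where bs: "distinct ([a, b] @ bs)" "set ([a, b] @ bs) \<subseteq> ?S"
      "length ([a, b] @ bs) = n - 4"
    by (rule leaf_list[of ?S "[a, b]" "n - 4"])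
      (use assms finite_nbhd[OF assms(1)] in auto)
  define ls where "ls = [a, b] @ bs"
  have d: "distinct (v # ls @ [x, y, z])"
    using bs assms(10,11) nbhd_irrefl[OF assms(1)] unfolding ls_def by auto
  have s: "set ls \<subseteq> nbhd G v" "length ls = n - 4" using bs by (auto simp: ls_def)
  have xyz: "{x, y, z} \<subseteq> verts G"
    using assms(7-9) nbhd_subset[OF assms(1)] by blast
  note emb = spider_embedding[OF assms(1-3) s d xyz]
  have l: "(v # ls @ [x, y, z]) ! 0 = v" "(v # ls @ [x, y, z]) ! 1 = a"
      "(v # ls @ [x, y, z]) ! 2 = b" by (simp_all add: ls_def)
  show ?thesis
  proof (rule contains_copyI[OF simple_graph_tree_T2[OF assms(2)] assms(1),
        where f = "\<lambda>i. (v # ls @ [x, y, z]) ! i"])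
    fix e assume "e \<in> edges (tree_T2 n)"
    then consider i where "i \<in> {1..n - 4}" "e = {0, i}" | "e = {1, n - 3}" | "e = {1, n - 2}"
      | "e = {2, n - 1}" by (auto simp: tree_T2_def)
    then show "(\<lambda>i. (v # ls @ [x, y, z]) ! i) ` e \<in> edges G"
    proof cases
      case 1
      then show ?thesis using emb(3) l by simp
    qed (use assms(7-9) in \<open>simp_all only: image_insert image_empty l emb nbhd_def mem_Collect_eq\<close>)
  qed (use emb in \<open>auto simp: tree_T2_def simp del: nth_Cons_Suc\<close>)
qed

text \<open>As for \<open>tree_T2\<close>; \<open>7 \<le> n\<close> makes room for \<open>a\<close>,
  \<open>b\<close> and \<open>c\<close> among the \<open>n - 4\<close> neighbours of the
  centre.\<close>

lemma contains_T3:
  assumes "simple_graph G" "7 \<le> n" "v \<in> verts G"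
    and "{a, b, c} \<subseteq> nbhd G v" "distinct [a, b, c]"
    and "x \<in> nbhd G a" "y \<in> nbhd G b" "z \<in> nbhd G c"
    and "distinct [x, y, z]" "{x, y, z} \<inter> {v, a, b, c} = {}"
    and "n - 4 \<le> card (nbhd G v - {x, y, z})"
  shows "contains_copy G (tree_T3 n)"
proof -
  let ?S = "nbhd G v - {x, y, z}"
  obtain bs where bs: "distinct ([a, b, c] @ bs)" "set ([a, b, c] @ bs) \<subseteq> ?S"
      "length ([a, b, c] @ bs) = n - 4"
    by (rule leaf_list[of ?S "[a, b, c]" "n - 4"])
      (use assms finite_nbhd[OF assms(1)] in auto)
  define ls where "ls = [a, b, c] @ bs"
  have n6: "6 \<le> n" using assms(2) by simp
  have d: "distinct (v # ls @ [x, y, z])"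
    using bs assms(9,10) nbhd_irrefl[OF assms(1)] unfolding ls_def by auto
  have s: "set ls \<subseteq> nbhd G v" "length ls = n - 4" using bs by (auto simp: ls_def)
  have xyz: "{x, y, z} \<subseteq> verts G"
    using assms(6-8) nbhd_subset[OF assms(1)] by blast
  note emb = spider_embedding[OF assms(1) n6 assms(3) s d xyz]
  have l: "(v # ls @ [x, y, z]) ! 0 = v" "(v # ls @ [x, y, z]) ! 1 = a"
      "(v # ls @ [x, y, z]) ! 2 = b" "(v # ls @ [x, y, z]) ! 3 = c"
    by (simp_all add: ls_def)
  show ?thesis
  proof (rule contains_copyI[OF simple_graph_tree_T3[OF n6] assms(1),
        where f = "\<lambda>i. (v # ls @ [x, y, z]) ! i"])
    fix e assume "e \<in> edges (tree_T3 n)"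
    then consider i where "i \<in> {1..n - 4}" "e = {0, i}" | "e = {1, n - 3}" | "e = {2, n - 2}"
      | "e = {3, n - 1}" by (auto simp: tree_T3_def)
    then show "(\<lambda>i. (v # ls @ [x, y, z]) ! i) ` e \<in> edges G"
    proof cases
      case 1
      then show ?thesis using emb(3) l by simp
    qed (use assms(6-8) in \<open>simp_all only: image_insert image_empty l emb nbhd_def mem_Collect_eq\<close>)
  qed (use emb in \<open>auto simp: tree_T3_def simp del: nth_Cons_Suc\<close>)
qed

section \<open>Dense graphs and the vertices outside a closed neighbourhood\<close>

locale dense_graph =
  fixes H :: "'a sgraph" and m n :: nat
  assumes simple: "simple_graph H"
    and order: "card (verts H) = m + n - 6"
    and min_degree: "\<And>v. v \<in> verts H \<Longrightarrow> n - 5 \<le> card (nbhd H v)"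
    and m_ge: "7 \<le> m" and n_ge: "m + 3 \<le> n"
begin

lemma n_ge_10: "10 \<le> n" using m_ge n_ge by simp

lemma finite_verts: "finite (verts H)" using simple by (simp add: simple_graph_def)

lemma nbhd_verts: "w \<in> nbhd H v \<Longrightarrow> w \<in> verts H" "w \<in> nbhd H v \<Longrightarrow> v \<in> verts H"
    "w \<in> nbhd H v \<Longrightarrow> w \<noteq> v"
  using nbhd_subset[OF simple, of v] nbhd_subset[OF simple, of w] nbhd_sym[of w H v] by blast+

text \<open>As \<open>n\<close> is at least 10, all degrees are at least 5, so four vertices can be
  avoided.\<close>

lemma ex_nbr:
  assumes "v \<in> nbhd H u" "length xs < 5"
  obtains w where "w \<in> nbhd H v" "w \<notin> set xs"
proof -
  have "length xs < card (nbhd H v)"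
    using min_degree[OF nbhd_verts(1)[OF assms(1)]] assms(2) n_ge_10 by linarith
  then show thesis using ex_outside_list that by blast
qed

definition far :: "'a \<Rightarrow> 'a set" where
  "far v = verts H - nbhd H v - {v}"

lemma far_iff: "c \<in> far v \<longleftrightarrow> c \<in> verts H \<and> c \<notin> nbhd H v \<and> c \<noteq> v"
  by (auto simp: far_def)

lemma finite_far: "finite (far v)" using finite_verts by (simp add: far_def)

lemma card_far: "v \<in> verts H \<Longrightarrow> card (far v) + card (nbhd H v) = m + n - 7"
proof -
  assume v: "v \<in> verts H"
  have "verts H - {v} = far v \<union> nbhd H v" "far v \<inter> nbhd H v = {}"
    using nbhd_subset[OF simple, of v] by (auto simp: far_def)
  then have "card (verts H - {v}) = card (far v) + card (nbhd H v)"
    using card_Un_disjoint[OF finite_far finite_nbhd[OF simple], of v v] by simp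
  moreover have "card (verts H - {v}) = m + n - 7" using v order finite_verts by simp
  ultimately show ?thesis by simp
qed

text \<open>Apart from common neighbours with \<open>v\<close>, the vertex \<open>c\<close> can only
  be adjacent to the other \<open>card (far v) - 1\<close> outer vertices, and its degree is at
  least \<open>n - 5\<close>.\<close>

lemma far_nbrs:
  assumes "v \<in> verts H" "c \<in> far v"
  shows "n - 4 \<le> card (nbhd H c \<inter> nbhd H v) + card (far v)"
proof -
  have "nbhd H c \<subseteq> (nbhd H c \<inter> nbhd H v) \<union> (far v - {c})"
    using assms nbhd_verts nbhd_sym by (fastforce simp: far_iff)
  then have "card (nbhd H c) \<le> card ((nbhd H c \<inter> nbhd H v) \<union> (far v - {c}))"
    by (intro card_mono) (auto simp: finite_far finite_nbhd[OF simple])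
  also have "\<dots> \<le> card (nbhd H c \<inter> nbhd H v) + card (far v - {c})" by (rule card_Un_le)
  finally have "n - 5 \<le> card (nbhd H c \<inter> nbhd H v) + (card (far v) - 1)"
    using min_degree[of c] assms by (simp add: far_iff finite_far)
  moreover have "0 < card (far v)" using assms finite_far card_gt_0_iff by fastforce
  ultimately show ?thesis by simp
qed

lemma ex_far_nbr:
  assumes "v \<in> verts H" "c \<in> far v" "length xs + card (far v) < n - 4"
  obtains w where "w \<in> nbhd H v" "c \<in> nbhd H w" "w \<in> nbhd H c" "w \<notin> set xs"
proof -
  have "length xs < card (nbhd H c \<inter> nbhd H v)" using far_nbrs[OF assms(1,2)] assms(3) by simp
  then obtain w where "w \<in> nbhd H c \<inter> nbhd H v" "w \<notin> set xs" using ex_outside_list by blast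
  then show thesis using that[of w] nbhd_sym[of w H c] by simp
qed

lemma card_Diff_ge:
  assumes "length xs + k \<le> card (nbhd H v)"
  shows "k \<le> card (nbhd H v - set xs)"
  using assms diff_card_le_card_Diff[of "set xs" "nbhd H v"] card_length[of xs] by simp

section \<open>Finding \<open>tree_T2\<close>\<close>

lemma T2_large:
  assumes v: "v \<in> verts H" "n - 3 \<le> card (nbhd H v)"
  shows "contains_copy H (tree_T2 n)"
\<comment> \<open>With at most one outer vertex the degree of \<open>v\<close> is at least
  \<open>n - 1\<close>, so three neighbours can be spent as pendant ends. Otherwise two ends
  \<open>p\<close> and \<open>q\<close> are outer vertices and at most one neighbour is
  spent.\<close>
proof (cases "card (far v) \<le> 1")
  case True
  have d: "n - 1 \<le> card (nbhd H v)" using True card_far[OF v(1)] m_ge by simp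
  then have outside: "9 \<le> card (nbhd H v)" using n_ge_10 by simp
  obtain a where a: "a \<in> nbhd H v" using ex_outside_list[of "[]" "nbhd H v"] outside by auto
  obtain x where x: "x \<in> nbhd H a" "x \<noteq> v"
    using ex_nbr[of a v "[v]"] a by auto
  obtain y where y: "y \<in> nbhd H a" "y \<noteq> v" "y \<noteq> x"
    using ex_nbr[of a v "[v, x]"] a by auto
  obtain b where b: "b \<in> nbhd H v" "b \<notin> {a, x, y}"
    using ex_outside_list[of "[a, x, y]" "nbhd H v"] outside by auto
  obtain z where z: "z \<in> nbhd H b" "z \<notin> {v, a, x, y}"
    using ex_nbr[of b v "[v, a, x, y]"] b by auto
  have "n - 4 \<le> card (nbhd H v - set [x, y, z])" by (rule card_Diff_ge) (use d n_ge_10 in simp)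
  then show ?thesis
    using a b x y z nbhd_irrefl[OF simple] n_ge_10
    by (intro contains_T2[OF simple _ v(1), of n a b x y z]) auto
next
  case False
  obtain p where p: "p \<in> far v" using ex_outside_list[of "[]" "far v"] False by auto
  obtain q where q: "q \<in> far v" "q \<noteq> p" using ex_outside_list[of "[p]" "far v"] False by auto
  have c: "3 + card (far v) \<le> n - 4" using card_far[OF v(1)] v(2) n_ge m_ge by simp
  obtain a where a: "a \<in> nbhd H v" "p \<in> nbhd H a"
    using ex_far_nbr[OF v(1) p, of "[]"] c by auto
  obtain b where b: "b \<in> nbhd H v" "q \<in> nbhd H b" "b \<noteq> a"
    using ex_far_nbr[OF v(1) q(1), of "[a]"] c by auto
  obtain x where x: "x \<in> nbhd H a" "x \<notin> {v, b, p, q}"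
    using ex_nbr[of a v "[v, b, p, q]"] a by auto
  have "n - 4 \<le> card (nbhd H v - set [x])" by (rule card_Diff_ge) (use v n_ge_10 in simp)
  moreover have "nbhd H v - {p, x, q} = nbhd H v - set [x]" using p q by (auto simp: far_iff)
  ultimately show ?thesis
    using a b x p q nbhd_irrefl[OF simple] n_ge_10
    by (intro contains_T2[OF simple _ v(1), of n a b p x q]) (auto simp: far_iff)
qed

lemma T2_exact:
  assumes v: "v \<in> verts H" "card (nbhd H v) = n - 4"
  shows "contains_copy H (tree_T2 n)"
proof -
  let ?D = "nbhd H v"
  have c: "card (far v) = m - 3" using card_far[OF v(1)] v(2) n_ge m_ge by simp
  then have far_ge: "4 \<le> card (far v)" using m_ge by simp
  have two: "1 + card (far v) < n - 4" using c n_ge m_ge by simp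
  \<comment> \<open>No neighbour of \<open>v\<close> can be spent, so all ends must be outer
    vertices. If each vertex of \<open>?D\<close> had at most one outer neighbour, there would be at
    most \<open>n - 4\<close> edges between \<open>?D\<close> and \<open>far v\<close>; but each of
    the \<open>m - 3\<close> outer vertices has at least \<open>n - m - 1\<close> of them.\<close>
  have "\<exists>a\<in>?D. 2 \<le> card (nbhd H a \<inter> far v)"
  proof (rule ccontr)
    assume *: "\<not> ?thesis"
    have "(m - 3) * (n - m - 1) = (\<Sum>p\<in>far v. n - m - 1)" using c by simp
    also have "\<dots> \<le> (\<Sum>p\<in>far v. card {a \<in> ?D. a \<in> nbhd H p})"
    proof (rule sum_mono)
      fix p assume "p \<in> far v"
      then have "n - m - 1 \<le> card (nbhd H p \<inter> ?D)"
        using far_nbrs[OF v(1)] c m_ge by fastforce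
      also have "nbhd H p \<inter> ?D = {a \<in> ?D. a \<in> nbhd H p}" by auto
      finally show "n - m - 1 \<le> card {a \<in> ?D. a \<in> nbhd H p}" .
    qed
    also have "\<dots> = (\<Sum>a\<in>?D. card {p \<in> far v. a \<in> nbhd H p})"
      by (rule sum_multicount_gen) (auto simp: finite_far finite_nbhd[OF simple])
    also have "\<dots> \<le> (\<Sum>a\<in>?D. 1)"
    proof (rule sum_mono)
      fix a assume "a \<in> ?D"
      moreover have "{p \<in> far v. a \<in> nbhd H p} = nbhd H a \<inter> far v" using nbhd_sym by fast
      ultimately show "card {p \<in> far v. a \<in> nbhd H p} \<le> 1" using * by force
    qed
    finally have le: "(m - 3) * (n - m - 1) \<le> n - 4" using v by simp
    \<comment> \<open>In these parameters the inequality reads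
      \<open>(k + 4) * (l + 2) \<le> k + l + 6\<close>, which is false.\<close>
    obtain k l where "m = k + 7" "n = m + 3 + l" using m_ge n_ge by (metis add.commute le_Suc_ex)
    then show False using le by (simp add: algebra_simps)
  qed
  then obtain a where a: "a \<in> ?D" "2 \<le> card (nbhd H a \<inter> far v)" by blast
  obtain x where x: "x \<in> nbhd H a" "x \<in> far v"
    using ex_outside_list[of "[]" "nbhd H a \<inter> far v"] a by auto
  obtain y where y: "y \<in> nbhd H a" "y \<in> far v" "y \<noteq> x"
    using ex_outside_list[of "[x]" "nbhd H a \<inter> far v"] a by auto
  obtain z where z: "z \<in> far v" "z \<notin> {x, y}"
    using ex_outside_list[of "[x, y]" "far v"] far_ge by auto
  obtain b where b: "b \<in> ?D" "z \<in> nbhd H b" "b \<noteq> a"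
    using ex_far_nbr[OF v(1) z(1), of "[a]"] two by auto
  have "?D - {x, y, z} = ?D" using x y z by (auto simp: far_iff)
  then show ?thesis
    using a b x y z n_ge_10 v nbhd_verts
    by (intro contains_T2[OF simple _ v(1), of n a b x y z]) (auto simp: far_iff)
qed

section \<open>Finding \<open>tree_T3\<close>\<close>

lemma T3_far:
  assumes v: "v \<in> verts H" "n - 4 \<le> card (nbhd H v)"
    and "{x, y, z} \<subseteq> far v" "distinct [x, y, z]"
    and "{a, b, c} \<subseteq> nbhd H v" "distinct [a, b, c]"
    and "x \<in> nbhd H a" "y \<in> nbhd H b" "z \<in> nbhd H c"
  shows "contains_copy H (tree_T3 n)"
proof -
  \<comment> \<open>Outer ends cost no neighbour of \<open>v\<close>, so a matching of size 3 into
    \<open>far v\<close> suffices.\<close>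
  have "nbhd H v - {x, y, z} = nbhd H v" using assms(3) by (auto simp: far_iff)
  then show ?thesis
    using assms n_ge_10
    by (intro contains_T3[OF simple _ v(1), of n a b c x y z]) (auto simp: far_iff)
qed

text \<open>Degree \<open>n - 1\<close> allows all three ends to be neighbours of
  \<open>v\<close>.\<close>

lemma T3_wasteful:
  assumes v: "v \<in> verts H" "n - 1 \<le> card (nbhd H v)"
    and "{a, b, c} \<subseteq> nbhd H v"
    and "x \<in> nbhd H a" "y \<in> nbhd H b" "z \<in> nbhd H c"
    and "distinct [v, a, b, c, x, y, z]"
  shows "contains_copy H (tree_T3 n)"
proof -
  have "n - 4 \<le> card (nbhd H v - set [x, y, z])" by (rule card_Diff_ge) (use v n_ge_10 in simp)
  then show ?thesis
    using assms n_ge_10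
    by (intro contains_T3[OF simple _ v(1), of n a b c x y z]) auto
qed

lemma T3_large:
  assumes v: "v \<in> verts H" "n - 3 \<le> card (nbhd H v)"
  shows "contains_copy H (tree_T3 n)"
proof -
  consider "card (far v) \<le> 1" | "card (far v) = 2" | "3 \<le> card (far v)" by linarith
  then show ?thesis
  proof cases
    case 1
    have d: "n - 1 \<le> card (nbhd H v)" using 1 card_far[OF v(1)] m_ge by simp
    then have outside: "9 \<le> card (nbhd H v)" using n_ge_10 by simp
    obtain a where a: "a \<in> nbhd H v"
      using ex_outside_list[of "[]" "nbhd H v"] outside by auto
    obtain x where x: "x \<in> nbhd H a" "x \<noteq> v"
      using ex_nbr[of a v "[v]"] a by auto
    obtain b where b: "b \<in> nbhd H v" "b \<notin> {a, x}"
      using ex_outside_list[of "[a, x]" "nbhd H v"] outside by auto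
    obtain y where y: "y \<in> nbhd H b" "y \<notin> {v, a, x}"
      using ex_nbr[of b v "[v, a, x]"] b by auto
    \<comment> \<open>The end of a third edge at \<open>c\<close> must avoid five vertices, while
      the minimum degree may be just 5. If no end is left, these five are exactly the neighbours of
      \<open>c\<close>.\<close>
    have third: "contains_copy H (tree_T3 n) \<or> {a, x} \<subseteq> nbhd H c"
      if c: "c \<in> nbhd H v" "c \<notin> {a, x, b, y}" for c
    proof (cases "nbhd H c \<subseteq> {v, a, x, b, y}")
      case True
      have "5 \<le> card (nbhd H c)"
        using min_degree[of c] c nbhd_verts n_ge_10 by fastforce
      moreover have "card {v, a, x, b, y} \<le> 5" using card_length[of "[v, a, x, b, y]"] by simp
      ultimately have "nbhd H c = {v, a, x, b, y}"
        using card_seteq[OF _ True] by simp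
      then show ?thesis by simp
    next
      case False
      then obtain z where "z \<in> nbhd H c" "z \<notin> {v, a, x, b, y}" by blast
      then have "contains_copy H (tree_T3 n)"
        using a b c x y nbhd_irrefl[OF simple]
        by (intro T3_wasteful[OF v(1) d, of a b c x y z]) auto
      then show ?thesis ..
    qed
    obtain c where c: "c \<in> nbhd H v" "c \<notin> {a, x, b, y}"
      using ex_outside_list[of "[a, x, b, y]" "nbhd H v"] outside by auto
    obtain e where e: "e \<in> nbhd H v" "e \<notin> {a, x, b, y, c}"
      using ex_outside_list[of "[a, x, b, y, c]" "nbhd H v"] outside by auto
    show ?thesis
    \<comment> \<open>If the third edge is blocked at both \<open>c\<close> and \<open>e\<close>,
      the edge from \<open>a\<close> to \<open>x\<close> is replaced by the edges from
      \<open>c\<close> to \<open>a\<close> and from \<open>e\<close> to \<open>x\<close>.\<close>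
    proof (cases "{a, x} \<subseteq> nbhd H c \<and> {a, x} \<subseteq> nbhd H e")
      case True
      then show ?thesis
        using a b c e x y nbhd_irrefl[OF simple]
        by (intro T3_wasteful[OF v(1) d, of c e b a x y]) auto
    next
      case False
      then show ?thesis using third[of c] third[of e] c e by blast
    qed
  next
    case 2
    have d: "n - 2 \<le> card (nbhd H v)" using 2 card_far[OF v(1)] m_ge by simp
    then have outside: "8 \<le> card (nbhd H v)" using n_ge_10 by simp
    \<comment> \<open>The choice of \<open>b\<close> avoids three vertices and has to allow for two
      outer ones. The vertex \<open>x\<close>, which may be a neighbour of \<open>v\<close>, is
      picked before \<open>a\<close> and \<open>b\<close> so that they can avoid it.\<close>
    have room: "5 < n - 4" using n_ge_10 by simp
    obtain p q where pq: "far v = {p, q}" "p \<noteq> q" using 2 by (auto simp: card_2_iff)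
    obtain w where w: "w \<in> nbhd H v"
      using ex_outside_list[of "[]" "nbhd H v"] outside by auto
    obtain x where x: "x \<in> nbhd H w" "x \<notin> {v, p, q}"
      using ex_nbr[of w v "[v, p, q]"] w by auto
    obtain a where a: "a \<in> nbhd H v" "p \<in> nbhd H a" "a \<notin> {w, x}"
      using ex_far_nbr[OF v(1), of p "[w, x]"] pq 2 room by auto
    obtain b where b: "b \<in> nbhd H v" "q \<in> nbhd H b" "b \<notin> {w, x, a}"
      using ex_far_nbr[OF v(1), of q "[w, x, a]"] pq 2 room by auto
    have "n - 4 \<le> card (nbhd H v - set [x])" by (rule card_Diff_ge) (use v n_ge_10 in simp)
    moreover have "p \<notin> nbhd H v" "q \<notin> nbhd H v" "p \<noteq> v" "q \<noteq> v"
      using pq far_iff by blast+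
    moreover from this have "nbhd H v - {x, p, q} = nbhd H v - set [x]" by auto
    ultimately show ?thesis
      using a b x w pq(2) nbhd_irrefl[OF simple] n_ge_10
      by (intro contains_T3[OF simple _ v(1), of n w a b x p q]) auto
  next
    case 3
    have c: "3 + card (far v) \<le> n - 4" using card_far[OF v(1)] v(2) n_ge m_ge by simp
    obtain x where x: "x \<in> far v" using ex_outside_list[of "[]" "far v"] 3 by auto
    obtain y where y: "y \<in> far v" "y \<noteq> x" using ex_outside_list[of "[x]" "far v"] 3 by auto
    obtain z where z: "z \<in> far v" "z \<notin> {x, y}"
      using ex_outside_list[of "[x, y]" "far v"] 3 by auto
    obtain a1 where a1: "a1 \<in> nbhd H v" "x \<in> nbhd H a1"
      using ex_far_nbr[OF v(1) x, of "[]"] c by auto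
    obtain a2 where a2: "a2 \<in> nbhd H v" "y \<in> nbhd H a2" "a2 \<noteq> a1"
      using ex_far_nbr[OF v(1) y(1), of "[a1]"] c by auto
    obtain a3 where a3: "a3 \<in> nbhd H v" "z \<in> nbhd H a3" "a3 \<notin> {a1, a2}"
      using ex_far_nbr[OF v(1) z(1), of "[a1, a2]"] c by auto
    show ?thesis
      using x y z a1 a2 a3 v
      by (intro T3_far[OF v(1), of x y z a1 a2 a3]) auto
  qed
qed

lemma T3_exact:
  assumes v: "v \<in> verts H" "card (nbhd H v) = n - 4"
    and max: "\<And>w. w \<in> verts H \<Longrightarrow> card (nbhd H w) \<le> n - 4"
  shows "contains_copy H (tree_T3 n)"
proof (rule ccontr)
  assume no: "\<not> ?thesis"
  let ?D = "nbhd H v"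
  have c: "card (far v) = m - 3" using card_far[OF v(1)] v(2) n_ge m_ge by simp
  then have far_ge: "4 \<le> card (far v)" using m_ge by simp
  have two: "1 + card (far v) < n - 4" using c n_ge m_ge by simp
  \<comment> \<open>A further neighbour \<open>e\<close> of \<open>q\<close> would give a matching
    of size 3: \<open>q\<close> with \<open>e\<close>, a third outer vertex \<open>r\<close> with
    some \<open>g\<close> other than \<open>e\<close>, and \<open>p\<close> with whichever of
    \<open>a\<close> and \<open>b\<close> is not \<open>g\<close>.\<close>
  have sub: "nbhd H q \<inter> ?D \<subseteq> {a, b}"
    if p: "p \<in> far v" and q: "q \<in> far v" "q \<noteq> p"
      and ab: "a \<in> ?D" "b \<in> ?D" "a \<noteq> b" "p \<in> nbhd H a" "p \<in> nbhd H b" for p q a b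
  proof (rule ccontr)
    assume "\<not> ?thesis"
    then obtain e where e: "e \<in> ?D" "q \<in> nbhd H e" "e \<notin> {a, b}" using nbhd_sym by fast
    obtain r where r: "r \<in> far v" "r \<notin> {p, q}"
      using ex_outside_list[of "[p, q]" "far v"] far_ge by auto
    obtain g where g: "g \<in> ?D" "r \<in> nbhd H g" "g \<noteq> e"
      using ex_far_nbr[OF v(1) r(1), of "[e]"] two by auto
    define h where "h = (if g = a then b else a)"
    have "h \<in> ?D" "p \<in> nbhd H h" "h \<notin> {e, g}" using ab e by (auto simp: h_def)
    then have "contains_copy H (tree_T3 n)"
      using p q r e g v by (intro T3_far[OF v(1), of p q r h e g]) auto
    with no show False by simp
  qed
  obtain p where p: "p \<in> far v" using ex_outside_list[of "[]" "far v"] far_ge by auto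
  obtain q where q: "q \<in> far v" "q \<noteq> p" using ex_outside_list[of "[p]" "far v"] far_ge by auto
  obtain a where a: "a \<in> ?D" "p \<in> nbhd H a" using ex_far_nbr[OF v(1) p, of "[]"] two by auto
  obtain b where b: "b \<in> ?D" "p \<in> nbhd H b" "b \<noteq> a"
    using ex_far_nbr[OF v(1) p, of "[a]"] two by auto
  \<comment> \<open>Every outer vertex has at least \<open>n - m - 1\<close>, hence at least 2,
    neighbours in \<open>?D\<close>.\<close>
  have eq: "nbhd H r \<inter> ?D = {a, b}" if r: "r \<in> far v" "r \<noteq> p" for r
  proof (rule card_seteq)
    show "nbhd H r \<inter> ?D \<subseteq> {a, b}" using sub[OF p r a(1) b(1)] a b by auto
    show "card {a, b} \<le> card (nbhd H r \<inter> ?D)"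
      using far_nbrs[OF v(1) r(1)] two b by simp
  qed simp
  \<comment> \<open>The same argument with \<open>p\<close> and \<open>q\<close> exchanged, as
    \<open>q\<close> is now known to be adjacent to \<open>a\<close> and \<open>b\<close>.\<close>
  have "nbhd H p \<inter> ?D \<subseteq> {a, b}"
    using sub[OF q(1) p _ a(1) b(1)] eq[OF q] q b nbhd_sym by fastforce
  with eq have far_sub: "nbhd H r \<inter> ?D \<subseteq> {a, b}" if "r \<in> far v" for r
    using that by (cases "r = p") auto
  have far_adj: "far v \<subseteq> nbhd H a" "far v \<subseteq> nbhd H b"
    using a b eq nbhd_sym by fastforce+
  have "card {a, b} = 2" using b by simp
  moreover have "card (nbhd H q \<inter> ?D) = 2" using eq[OF q] calculation by simp
  \<comment> \<open>Having only two neighbours in \<open>?D\<close> makes the bound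
    \<open>n - m - 1 \<le> 2\<close> tight.\<close>
  ultimately have nm: "n = m + 3" using far_nbrs[OF v(1) q(1)] c n_ge m_ge by simp
  \<comment> \<open>Such a \<open>w\<close> is already adjacent to \<open>v\<close> and to
    \<open>m - 3 = n - 6\<close> outer vertices, and its degree is at most
    \<open>n - 4\<close>.\<close>
  have few: "card (nbhd H w \<inter> ?D) \<le> 1" if w: "w \<in> ?D" "far v \<subseteq> nbhd H w" for w
  proof -
    have wV: "w \<in> verts H" using w nbhd_verts by blast
    have vw: "v \<in> nbhd H w" "v \<notin> far v" "v \<notin> ?D"
      using w nbhd_sym[of v H w] nbhd_irrefl[OF simple] by (simp_all add: far_iff)
    have "card (insert v (far v)) + card (nbhd H w \<inter> ?D)
        = card (insert v (far v) \<union> (nbhd H w \<inter> ?D))"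
      using vw by (intro card_Un_disjoint[symmetric])
        (auto simp: finite_far finite_nbhd[OF simple] far_iff)
    also have "\<dots> \<le> card (nbhd H w)"
      using vw w by (intro card_mono) (auto simp: finite_nbhd[OF simple])
    also have "\<dots> \<le> n - 4" by (rule max[OF wV])
    finally show ?thesis using vw c nm m_ge finite_far by simp
  qed
  \<comment> \<open>A vertex \<open>w\<close> of \<open>?D\<close> other than \<open>a\<close> and
    \<open>b\<close> has no outer neighbours. If it also missed \<open>a\<close> and
    \<open>b\<close>, its degree would be at most \<open>1 + (n - 7)\<close>, below the
    minimum.\<close>
  have "?D - {a, b} \<subseteq> (nbhd H a \<inter> ?D) \<union> (nbhd H b \<inter> ?D)"
  proof
    fix w assume w: "w \<in> ?D - {a, b}"
    show "w \<in> (nbhd H a \<inter> ?D) \<union> (nbhd H b \<inter> ?D)"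
    proof (rule ccontr)
      assume "\<not> ?thesis"
      then have "a \<notin> nbhd H w" "b \<notin> nbhd H w" using w nbhd_sym by fast+
      moreover have "r \<notin> far v" if "r \<in> nbhd H w" for r
        using far_sub[of r] that w nbhd_sym by fast
      ultimately have "nbhd H w \<subseteq> insert v (?D - {a, b, w})"
        using nbhd_verts nbhd_irrefl[OF simple] by (fastforce simp: far_iff)
      then have "card (nbhd H w) \<le> card (insert v (?D - {a, b, w}))"
        by (intro card_mono) (auto simp: finite_nbhd[OF simple])
      also have "\<dots> \<le> Suc (card (?D - {a, b, w}))" by (rule card_insert_le_m1) simp_all
      also have "card (?D - {a, b, w}) = n - 7"
        using a b w v by (subst card_Diff_subset) auto
      finally show False using min_degree[of w] w nbhd_verts n_ge_10 by fastforce
    qed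
  qed
  then have "card (?D - {a, b}) \<le> card ((nbhd H a \<inter> ?D) \<union> (nbhd H b \<inter> ?D))"
    by (intro card_mono) (auto simp: finite_nbhd[OF simple])
  also have "\<dots> \<le> 2"
    using card_Un_le[of "nbhd H a \<inter> ?D" "nbhd H b \<inter> ?D"] few[OF a(1) far_adj(1)]
      few[OF b(1) far_adj(2)] by simp
  finally have "card (?D - {a, b}) \<le> 2" .
  moreover have "card (?D - {a, b}) = n - 6"
    using a b v by (subst card_Diff_subset) auto
  ultimately show False using n_ge_10 by simp
qed

lemma contains_trees:
  assumes "v \<in> verts H" "n - 4 \<le> card (nbhd H v)"
  shows "contains_copy H (tree_T2 n)" "contains_copy H (tree_T3 n)"
proof -
  show "contains_copy H (tree_T2 n)"
    using T2_large[of v] T2_exact[of v] assms by linarith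
  show "contains_copy H (tree_T3 n)"
  \<comment> \<open>A vertex of larger degree, if there is one, replaces \<open>v\<close> as centre;
    otherwise \<open>v\<close> has maximum degree, as \<open>T3_exact\<close> requires.\<close>
  proof (cases "\<exists>w\<in>verts H. n - 3 \<le> card (nbhd H w)")
    case True
    then show ?thesis using T3_large by blast
  next
    case False
    then have "card (nbhd H w) \<le> n - 4" if "w \<in> verts H" for w using that by force
    then show ?thesis using T3_exact[of v] assms by (simp add: le_antisym)
  qed
qed

end

section \<open>The upper bound\<close>

lemma star_or_trees:
  assumes "7 \<le> m" "m + 3 \<le> n" "odd m" "even n"
    and G: "simple_graph G" "card (verts G) = m + n - 6"
  shows "contains_copy G (star (m - 1)) \<or>
    contains_copy (complement G) (tree_T2 n) \<and> contains_copy (complement G) (tree_T3 n)"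
proof (cases "\<exists>v\<in>verts G. m - 1 \<le> card (nbhd G v)")
  case True
  then show ?thesis using contains_star[OF G(1)] by blast
next
  case False
  let ?H = "complement G"
  have H: "simple_graph ?H" "verts ?H = verts G"
    using simple_graph_complement[OF G(1)] by (auto simp: complement_def)
  \<comment> \<open>Degree at most \<open>m - 2\<close> in \<open>G\<close> leaves at least
    \<open>(m + n - 7) - (m - 2) = n - 5\<close> in the complement.\<close>
  have deg: "n - 5 \<le> card (nbhd ?H v)" if v: "v \<in> verts G" for v
  proof -
    have "card (nbhd G v) < m - 1" using False v by force
    then show ?thesis using card_nbhd_complement[OF G(1) v] G(2) assms(1,2) by simp
  qed
  interpret dense_graph ?H m n
    using H G deg assms by unfold_locales auto
  have "\<exists>v\<in>verts G. n - 4 \<le> card (nbhd ?H v)"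
  proof (rule ccontr)
    assume *: "\<not> ?thesis"
    have "card (nbhd ?H v) = n - 5" if "v \<in> verts G" for v
    proof -
      have "\<not> n - 4 \<le> card (nbhd ?H v)" using * that by blast
      then show ?thesis using deg[OF that] by linarith
    qed
    then have "(m + n - 6) * (n - 5) = 2 * card (edges ?H)"
      using handshake[OF H(1)] H(2) G(2) by simp
    moreover have "odd (m + n - 6)" "odd (n - 5)" using assms by simp_all
    ultimately show False by (metis dvd_triv_left even_mult_iff)
  qed
  then show ?thesis using contains_trees H(2) by auto
qed

section \<open>The lower bound\<close>

text \<open>Induced subgraphs of a circulant graph of degree \<open>2 * r\<close> on \<open>M\<close> vertices; passing to an
  induced subgraph only decreases the degrees in the graph and in its complement, which covers
  all orders \<open>N \<le> M\<close> at once.\<close>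

definition circulant :: "nat \<Rightarrow> nat \<Rightarrow> nat \<Rightarrow> nat sgraph" where
  "circulant M r N = \<lparr>verts = {0..<N},
     edges = {{i, j} |i j. i < j \<and> j < N \<and> (j - i \<le> r \<or> M - r \<le> j - i)}\<rparr>"

lemma simple_graph_circulant: "simple_graph (circulant M r N)"
  by (auto simp: simple_graph_def circulant_def)

lemma nbhd_circulant:
  "w \<in> nbhd (circulant M r N) v \<longleftrightarrow>
     v < N \<and> w < N \<and> (v < w \<and> (w - v \<le> r \<or> M - r \<le> w - v) \<or>
     w < v \<and> (v - w \<le> r \<or> M - r \<le> v - w))"
  by (auto simp: nbhd_def circulant_def doubleton_eq_iff)

lemma circulant_degrees:
  assumes "2 * r < M" "N \<le> M"
  shows "card (nbhd (circulant M r N) v) \<le> 2 * r"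
    and "card (nbhd (complement (circulant M r N)) v) \<le> M - 1 - 2 * r"
proof -
  \<comment> \<open>\<open>f\<close> adds an offset to \<open>v\<close> modulo \<open>M\<close>; a
    downward difference \<open>v - w\<close> is the offset \<open>M - (v - w)\<close>. Neighbours
    have offsets in \<open>{1..r}\<close> or \<open>{M - r..<M}\<close>, non-neighbours other than
    \<open>v\<close> have the offsets in between.\<close>
  define f where "f = (\<lambda>t. (v + t) mod M)"
  have up: "w = f (w - v)" if "v < w" "w < N" for w using that assms by (simp add: f_def)
  have down: "w = f (M - (v - w))" if "w < v" "v < N" for w
  proof -
    have "v + (M - (v - w)) = M + w" using that assms by simp
    then show ?thesis using that assms by (simp add: f_def)
  qed
  have "nbhd (circulant M r N) v \<subseteq> f ` ({1..r} \<union> {M - r..<M})"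
  proof
    fix w assume "w \<in> nbhd (circulant M r N) v"
    then consider "v < w" "w < N" "w - v \<le> r \<or> M - r \<le> w - v"
      | "w < v" "v < N" "v - w \<le> r \<or> M - r \<le> v - w"
      unfolding nbhd_circulant by blast
    then show "w \<in> f ` ({1..r} \<union> {M - r..<M})"
    proof cases
      case 1
      then have "w - v \<in> {1..r} \<union> {M - r..<M}" using assms by auto
      then show ?thesis using up[OF 1(1,2)] by blast
    next
      case 2
      then have "M - (v - w) \<in> {1..r} \<union> {M - r..<M}" using assms by auto
      then show ?thesis using down[OF 2(1,2)] by blast
    qed
  qed
  then have "card (nbhd (circulant M r N) v) \<le> card ({1..r} \<union> {M - r..<M})"
    by (rule surj_card_le[rotated]) simp
  also have "\<dots> \<le> 2 * r" using card_Un_le[of "{1..r}" "{M - r..<M}"] assms by simp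
  finally show "card (nbhd (circulant M r N) v) \<le> 2 * r" .
  have "nbhd (complement (circulant M r N)) v \<subseteq> f ` {r + 1..<M - r}"
  proof
    fix w assume "w \<in> nbhd (complement (circulant M r N)) v"
    then have w: "v < N" "w < N" "v \<noteq> w" "w \<notin> nbhd (circulant M r N) v"
      by (auto simp: nbhd_def complement_def circulant_def card_insert_if split: if_splits)
    show "w \<in> f ` {r + 1..<M - r}"
    proof (cases "v < w")
      case True
      then have "w - v \<in> {r + 1..<M - r}" using w assms by (auto simp: nbhd_circulant)
      then show ?thesis using up[OF True w(2)] by blast
    next
      case False
      then have "w < v" using w by simp
      then have "M - (v - w) \<in> {r + 1..<M - r}" using w assms by (auto simp: nbhd_circulant)
      then show ?thesis using down[OF \<open>w < v\<close> w(1)] by blast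
    qed
  qed
  then have "card (nbhd (complement (circulant M r N)) v) \<le> card {r + 1..<M - r}"
    by (rule surj_card_le[rotated]) simp
  then show "card (nbhd (complement (circulant M r N)) v) \<le> M - 1 - 2 * r" by simp
qed

lemma nbhd_star: "{1..k} \<subseteq> nbhd (star k) 0"
  by (auto simp: nbhd_def star_def)

text \<open>Of the trees, the lower bound uses only that vertex \<open>0\<close> has degree at least
  \<open>n - 4\<close>.\<close>

lemma ramsey_number_star_eqI:
  assumes "7 \<le> m" "m + 3 \<le> n" "odd m"
    and T: "simple_graph T" "0 \<in> verts T" "{1..n - 4} \<subseteq> nbhd T (0 :: nat)"
    and upper: "\<And>G :: nat sgraph. simple_graph G \<Longrightarrow> card (verts G) = m + n - 6 \<Longrightarrow>
      contains_copy G (star (m - 1)) \<or> contains_copy (complement G) T"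
  shows "ramsey_number (star (m - 1)) T = m + n - 6"
  unfolding ramsey_number_def
proof (rule Least_equality, intro conjI allI impI)
  fix N assume N: "0 < N \<and> (\<forall>G :: nat sgraph. simple_graph G \<and> card (verts G) = N \<longrightarrow>
    contains_copy G (star (m - 1)) \<or> contains_copy (complement G) T)"
  show "m + n - 6 \<le> N"
  proof (rule ccontr)
    assume less: "\<not> m + n - 6 \<le> N"
    obtain k where "m = 2 * k + 1" using assms(3) by (rule oddE)
    \<comment> \<open>With \<open>2 * r = m - 3\<close> and \<open>M = m + n - 7\<close>, the
      degrees are at most \<open>m - 3\<close> in the circulant graph and
      \<open>M - 1 - 2 * r = n - 5\<close> in its complement, too small for either centre.\<close>
    then obtain r where r: "m = 2 * r + 3" using assms(1) that[of "k - 1"] by simp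
    let ?G = "circulant (m + n - 7) r N"
    have M: "2 * r < m + n - 7" "N \<le> m + n - 7" using r less assms(1,2) by auto
    have "card (verts ?G) = N" by (simp add: circulant_def)
    then consider "contains_copy ?G (star (m - 1))" | "contains_copy (complement ?G) T"
      using N simple_graph_circulant by blast
    then show False
    proof cases
      case 1
      then obtain v where "card (nbhd (star (m - 1)) 0) \<le> card (nbhd ?G v)"
        using contains_copy_degree[OF simple_graph_star simple_graph_circulant 1, of 0]
        by (auto simp: star_def)
      moreover have "card {1..m - 1} \<le> card (nbhd (star (m - 1)) 0)"
        by (intro card_mono nbhd_star finite_nbhd simple_graph_star)
      ultimately show False using circulant_degrees(1)[OF M, of v] r by simp
    next
      case 2
      then obtain v where "card (nbhd T 0) \<le> card (nbhd (complement ?G) v)"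
        using contains_copy_degree[OF T(1) simple_graph_complement[OF simple_graph_circulant] 2 T(2)]
        by auto
      moreover have "card {1..n - 4} \<le> card (nbhd T 0)"
        using T by (intro card_mono finite_nbhd)
      ultimately show False using circulant_degrees(2)[OF M, of v] r assms(1,2) by simp
    qed
  qed
qed (use assms upper in auto)

theorem theorem4p5:
  fixes m n :: nat
  assumes "m \<ge> 6" and "n \<ge> m + 3" and "\<not> 2 dvd m * (n - 1)"
  shows "ramsey_number (star (m - 1)) (tree_T2 n) = m + n - 6 \<and>
         ramsey_number (star (m - 1)) (tree_T3 n) = m + n - 6"
proof -
  have "odd m" "odd (n - 1)" using assms(3) by auto
  then have "even n" using assms(1,2) by simp
  have "m \<noteq> 6" using \<open>odd m\<close> by auto
  then have "7 \<le> m" using assms(1) by simp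
  note upper = star_or_trees[OF \<open>7 \<le> m\<close> assms(2) \<open>odd m\<close> \<open>even n\<close>]
  have n: "6 \<le> n" using assms by simp
  have "ramsey_number (star (m - 1)) (tree_T2 n) = m + n - 6"
  proof (rule ramsey_number_star_eqI[OF \<open>7 \<le> m\<close> assms(2) \<open>odd m\<close>])
    show "simple_graph (tree_T2 n)" using n by (rule simple_graph_tree_T2)
    show "0 \<in> verts (tree_T2 n)" using n by (simp add: tree_T2_def)
    show "{1..n - 4} \<subseteq> nbhd (tree_T2 n) 0" by (auto simp: tree_T2_def nbhd_def)
  qed (use upper in blast)
  moreover have "ramsey_number (star (m - 1)) (tree_T3 n) = m + n - 6"
  proof (rule ramsey_number_star_eqI[OF \<open>7 \<le> m\<close> assms(2) \<open>odd m\<close>])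
    show "simple_graph (tree_T3 n)" using n by (rule simple_graph_tree_T3)
    show "0 \<in> verts (tree_T3 n)" using n by (simp add: tree_T3_def)
    show "{1..n - 4} \<subseteq> nbhd (tree_T3 n) 0" by (auto simp: tree_T3_def nbhd_def)
  qed (use upper in blast)
  ultimately show ?thesis ..
qed

end
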